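(* Let $d\ge 1$ and let $\mathcal G=T^{hom}_{poly}(\mathbb R^d)$ be the Gerstenhaber algebra of homogeneous polyvector fields on $\mathbb R^d$, with wedge product and Schouten bracket. Let $\mathcal G'=\mathbb R$ be the Gerstenhaber algebra concentrated in degree $0$ with the usual multiplication and zero bracket, and let $f_1:\mathcal G\to\mathbb R$ be the Gerstenhaber algebra morphism given by projection onto the degree $0$ component. Then the Chevalley–Harrison cohomology of $T^{hom}_{poly}(\mathbb R^d)$ with values in $\mathbb R$ (relative to $f_1$) is not trivial, i.e. the cohomology of the complex $(C^\bullet,d_{CH})$ described in the context is nonzero.
   Context: **The algebra.** $\mathcal G=T^{hom}_{poly}(\mathbb R^d)$ is the space of totally antisymmetric tensor fields spanned by those $\alpha=\sum_{i_1<\dots<i_k}\alpha^{i_1\dots i_k}\partial_{i_1}\wedge\dots\wedge\partial_{i_k}$ ($0\le k\le d$) all of whose coefficients $\alpha^{i_1\dots i_k}$ are homogeneous polynomials of degree $k$ on $\mathbb R^d$; such an $\alpha$ has degree $|\alpha|=k$ (so degree $0$ elements are constants and degree $1$ elements are linear vector fields). The Schouten bracket $[\ ,\ ]$ is the bracket of degree $-1$ with $[\alpha,\beta]=-(-1)^{(|\alpha|-1)(|\beta|-1)}[\beta,\alpha]$, $[\alpha,\beta\wedge\gamma]=[\alpha,\beta]\wedge\gamma+(-1)^{|\beta|(|\alpha|-1)}\beta\wedge[\alpha,\gamma]$, extending the Lie bracket of vector fields and $[X,h]=X(h)$ for $X$ a vector field and $h$ a function. $\mathcal G$ is closed under $\wedge$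 and $[\ ,\ ]$. **Conventions.** $V[1]$ is the graded space $V$ with degrees lowered by $1$. Koszul signs: exchanging adjacent elements of degrees $x,y$ costs $(-1)^{xy}$; $\varepsilon(\dots)$ denotes the resulting sign of a permutation of graded elements. For $\alpha\in\mathcal G$ the degree in $\mathcal G[1]$ is $a=|\alpha|-1$. **The space $\mathcal H$.** $Bat(p,q)$ is the set of permutations $\sigma$ of $\{1,\dots,p+q\}$ with $\sigma(1)<\dots<\sigma(p)$ and $\sigma(p+1)<\dots<\sigma(p+q)$. On tensors over $\mathcal G[1]$, $bat_{p,q}(\alpha_1\otimes\dots\otimes\alpha_p,\alpha_{p+1}\otimes\dots\otimes\alpha_{p+q})=\sum_{\sigma\in Bat(p,q)}\varepsilon\binom{a_1\dots a_{p+q}}{a_{\sigma^{-1}(1)}\dots a_{\sigma^{-1}(p+q)}}\alpha_{\sigma^{-1}(1)}\otimes\dots\otimes\alpha_{\sigma^{-1}(p+q)}$. $\underline\bigotimes^n(\mathcal G[1])$ is the quotient of $(\mathcal G[1])^{\otimes n}$ by the sum of the images of $bat_{p,n-p}$, $0<p<n$; the class of $\alpha_1\otimes\dots\otimes\alpha_n$ is written $\alpha_1\underline\otimes\dots\underline\otimes\alpha_n$. $\mathcal H=\bigoplus_{n\ge1}\underline\bigotimes^n(\mathcal G[1])$. With $\mu_2(\alpha,\beta)=(-1)^a\alpha\wedge\beta$, put on $\mathcal H$ $$\mu(\alpha_1\underline\otimes\dots\underline\otimes\alpha_n)=\sum_{0<j<n}(-1)^{a_1+\dots+a_{j-1}}\alpha_1\underline\otimes\dots\underline\otimes\mu_2(\alpha_j,\alpha_{j+1})\underline\otimes\dots\underline\otimes\alpha_n,$$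 $$[\alpha_1\underline\otimes\dots\underline\otimes\alpha_p,\alpha_{p+1}\underline\otimes\dots\underline\otimes\alpha_{p+q}]=\sum_{\sigma,k}\varepsilon\binom{a_1\dots a_{p+q}}{a_{\sigma^{-1}(1)}\dots a_{\sigma^{-1}(p+q)}}\alpha_{\sigma^{-1}(1)}\underline\otimes\dots\underline\otimes[\alpha_{\sigma^{-1}(k)},\alpha_{\sigma^{-1}(k+1)}]\underline\otimes\dots\underline\otimes\alpha_{\sigma^{-1}(p+q)},$$ sum over $\sigma\in Bat(p,q)$ and $k$ with $\sigma^{-1}(k)\le p<\sigma^{-1}(k+1)$ (these are well defined). **Symmetric coalgebra.** An element ("packet") $X=\alpha_1\underline\otimes\dots\underline\otimes\alpha_p$ has degree $x=a_1+\dots+a_p-1$ in $\mathcal H[1]$; write $p(X)=p$. $S^+(\mathcal H[1])$ is the graded symmetric algebra without unit, with product denoted by a dot. On it $$m(X_1\cdot\ldots\cdot X_n)=\sum_j(-1)^{\sum_{r<j}x_r}X_1\cdot\ldots\cdot\mu(X_j)\cdot\ldots\cdot X_n,$$ $$\ell(X_1\cdot\ldots\cdot X_n)=\sum_{i<j}\varepsilon\binom{x_1\dots x_n}{x_ix_jx_1\dots\hat\imath\dots\hat\jmath\dots x_n}\ell_2(X_i,X_j)\cdot X_1\cdot\ldots\hat\imath\ldots\hat\jmath\ldots\cdot X_n,\qquad \ell_2(X,Y)=(-1)^x[X,Y].$$ **The complex.** For $N\ge1$, $C^N$ is the space of linear maps to $\mathbb R$ from the span of all $X_1\cdot\ldots\cdot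 X_n$ ($n\ge1$) with $p(X_1)+\dots+p(X_n)=N$; $C^0=0$. A cochain $f$ is homogeneous of degree $|f|$ if it vanishes on elements of $S^+(\mathcal H[1])$ of total degree $\ne-2-|f|$ (i.e. its target $\mathbb R=\mathcal G'[1][1]$ sits in degree $-2$). The coboundary $d_{CH}:C^N\to C^{N+1}$ is, for homogeneous $f$ and $X_j=\alpha^j_1\underline\otimes\dots\underline\otimes\alpha^j_{p_j}$, $$\begin{aligned}(d_{CH}f)(X_1\cdot\ldots\cdot X_n)=&-\sum_{j:\,p_j\ge2}(-1)^{a^j_1(|f|+\sum_{i<j}x_i)}f_1(\alpha^j_1)\,f\big(X_1\cdot\ldots\cdot(\alpha^j_2\underline\otimes\dots\underline\otimes\alpha^j_{p_j})\cdot\ldots\cdot X_n\big)\\&-\sum_{j:\,p_j\ge2}(-1)^{a^j_{p_j}\sum_{i>j}x_i}f\big(X_1\cdot\ldots\cdot(\alpha^j_1\underline\otimes\dots\underline\otimes\alpha^j_{p_j-1})\cdot\ldots\cdot X_n\big)\,f_1(\alpha^j_{p_j})\\&-(-1)^{|f|}f\big((\ell+m)(X_1\cdot\ldots\cdot X_n)\big),\end{aligned}$$ extended linearly; it satisfies $d_{CH}\circ d_{CH}=0$. The cohomology is $\bigoplus_{N\ge 1}\ker(d_{CH}|_{C^N})/d_{CH}(C^{N-1})$. *)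

theory Defs
  imports
    "HOL-Analysis.Finite_Function_Topology"
    "HOL-Library.FuncSet"
    "HOL-Combinatorics.Permutations"
begin

section \<open>Homogeneous polyvector fields\<close>

text \<open>
  Real polynomials in variables \<open>x\<^sub>i\<close> (\<open>i :: nat\<close>) are finitely supported families of coefficients
  indexed by exponents.  A polynomial polyvector field
  \<open>\<alpha> = \<Sum>\<^sub>I \<alpha>\<^sup>I \<partial>\<^sub>I\<close> is the finitely supported family of its coefficients, where for
  \<open>I = {i\<^sub>1 < \<dots> < i\<^sub>k}\<close> we write \<open>\<partial>\<^sub>I = \<partial>\<^bsub>i\<^sub>1\<^esub> \<and> \<dots> \<and> \<partial>\<^bsub>i\<^sub>k\<^esub>\<close>.
  On \<open>\<real>\<^sup>d\<close> the indices run through \<open>{1..d}\<close>.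
\<close>

type_synonym mpoly = "(nat \<Rightarrow>\<^sub>0 nat) \<Rightarrow>\<^sub>0 real"
type_synonym polyvec = "nat set \<Rightarrow>\<^sub>0 mpoly"

definition ksgn :: "int \<Rightarrow> real" where
  "ksgn e = (if even e then 1 else - 1)"

definition homogeneous_mpoly :: "nat \<Rightarrow> nat \<Rightarrow> mpoly \<Rightarrow> bool" where
  "homogeneous_mpoly d k p \<longleftrightarrow>
     (\<forall>m \<in> Poly_Mapping.keys p.
        Poly_Mapping.keys m \<subseteq> {1..d} \<and>
        (\<Sum>i \<in> Poly_Mapping.keys m. Poly_Mapping.lookup m i) = k)"

definition hom_polyvec :: "nat \<Rightarrow> nat \<Rightarrow> polyvec set" where
  "hom_polyvec d k =
     {\<alpha>. \<forall>I \<in> Poly_Mapping.keys \<alpha>.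
        I \<subseteq> {1..d} \<and> card I = k \<and> homogeneous_mpoly d k (Poly_Mapping.lookup \<alpha> I)}"

text \<open>
  The homogeneous elements of \<open>\<G> = \<Oplus>\<^sub>k hom_polyvec d k\<close>, on which everything below is generated.
\<close>

definition homs :: "nat \<Rightarrow> polyvec set" where
  "homs d = (\<Union>k. hom_polyvec d k)"

text \<open>
  The degree of a homogeneous element is unique unless the element is zero.  The value \<open>0\<close> chosen
  for \<open>\<alpha> = 0\<close> is irrelevant: a tensor with a zero factor vanishes.
\<close>

definition pdeg :: "nat \<Rightarrow> polyvec \<Rightarrow> nat" where
  "pdeg d \<alpha> = (LEAST k. \<alpha> \<in> hom_polyvec d k)"

text \<open>The degree \<open>a = |\<alpha>| - 1\<close> in \<open>\<G>[1]\<close>.\<close>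

definition sdeg :: "nat \<Rightarrow> polyvec \<Rightarrow> int" where
  "sdeg d \<alpha> = int (pdeg d \<alpha>) - 1"

text \<open>For disjoint \<open>I\<close>, \<open>J\<close> one has \<open>\<partial>\<^sub>I \<and> \<partial>\<^sub>J = (-1)\<^sup>s \<partial>\<^bsub>I \<union> J\<^esub>\<close> with
  \<open>s\<close> the number of pairs \<open>(i, j) \<in> I \<times> J\<close> such that \<open>j < i\<close>.\<close>

definition wedge :: "polyvec \<Rightarrow> polyvec \<Rightarrow> polyvec" where
  "wedge \<alpha> \<beta> =
     (\<Sum>I \<in> Poly_Mapping.keys \<alpha>. \<Sum>J \<in> Poly_Mapping.keys \<beta>.
        if I \<inter> J = {}
        then ksgn (int (card {(i, j). i \<in> I \<and> j \<in> J \<and> j < i})) *\<^sub>R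
               Poly_Mapping.single (I \<union> J) (Poly_Mapping.lookup \<alpha> I * Poly_Mapping.lookup \<beta> J)
        else 0)"

definition pderiv_mpoly :: "nat \<Rightarrow> mpoly \<Rightarrow> mpoly" where
  "pderiv_mpoly i p =
     (\<Sum>m \<in> Poly_Mapping.keys p.
        Poly_Mapping.single (m - Poly_Mapping.single i 1)
          (of_nat (Poly_Mapping.lookup m i) * Poly_Mapping.lookup p m))"

definition pderiv_polyvec :: "nat \<Rightarrow> polyvec \<Rightarrow> polyvec" where
  "pderiv_polyvec i \<alpha> =
     (\<Sum>I \<in> Poly_Mapping.keys \<alpha>.
        Poly_Mapping.single I (pderiv_mpoly i (Poly_Mapping.lookup \<alpha> I)))"

text \<open>
  The left and the right derivative with respect to the odd variable \<open>\<partial>\<^sub>i\<close>: move \<open>\<partial>\<^sub>i\<close> to the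
  front (respectively to the end) of \<open>\<partial>\<^sub>I\<close> and delete it.
\<close>

definition left_odd_deriv :: "nat \<Rightarrow> polyvec \<Rightarrow> polyvec" where
  "left_odd_deriv i \<alpha> =
     (\<Sum>I \<in> {I \<in> Poly_Mapping.keys \<alpha>. i \<in> I}.
        ksgn (int (card {j \<in> I. j < i})) *\<^sub>R
          Poly_Mapping.single (I - {i}) (Poly_Mapping.lookup \<alpha> I))"

definition right_odd_deriv :: "nat \<Rightarrow> polyvec \<Rightarrow> polyvec" where
  "right_odd_deriv i \<alpha> =
     (\<Sum>I \<in> {I \<in> Poly_Mapping.keys \<alpha>. i \<in> I}.
        ksgn (int (card {j \<in> I. i < j})) *\<^sub>R
          Poly_Mapping.single (I - {i}) (Poly_Mapping.lookup \<alpha> I))"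

text \<open>
  For fixed \<open>\<alpha>\<close> of degree \<open>k\<close> the right-hand side is a derivation of degree \<open>k - 1\<close> of the
  wedge product in \<open>\<beta>\<close>, i.e.
  \<open>[\<alpha>, \<beta> \<and> \<gamma>] = [\<alpha>, \<beta>] \<and> \<gamma> + (-1)\<^bsup>|\<beta>|(|\<alpha>|-1)\<^esup> \<beta> \<and> [\<alpha>, \<gamma>]\<close>.  With \<open>[X, h] = X(h)\<close>,
  the Lie bracket of vector fields and
  \<open>[\<alpha>, \<beta>] = -(-1)\<^bsup>(|\<alpha>|-1)(|\<beta>|-1)\<^esup> [\<beta>, \<alpha>]\<close> this determines the Schouten bracket.
\<close>

definition schouten :: "nat \<Rightarrow> polyvec \<Rightarrow> polyvec \<Rightarrow> polyvec" where
  "schouten d \<alpha> \<beta> =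
     (\<Sum>i = 1..d. wedge (right_odd_deriv i \<alpha>) (pderiv_polyvec i \<beta>)
                - wedge (pderiv_polyvec i \<alpha>) (left_odd_deriv i \<beta>))"

text \<open>The morphism \<open>\<G> \<rightarrow> \<real>\<close>: the constant term of the coefficient of \<open>\<partial>\<^bsub>{}\<^esub> = 1\<close>.\<close>

definition f1 :: "polyvec \<Rightarrow> real" where
  "f1 \<alpha> = Poly_Mapping.lookup (Poly_Mapping.lookup \<alpha> {}) 0"


section \<open>Koszul signs and shuffles\<close>

text \<open>
  All positions are counted from \<open>0\<close>.  \<open>koszul [a\<^sub>0, \<dots>, a\<^sub>n] [i\<^sub>0, \<dots>, i\<^sub>n]\<close> is the sign
  for passing from the order \<open>0, \<dots>, n\<close> to the order \<open>i\<^sub>0, \<dots>, i\<^sub>n\<close>: each inverted pair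
  contributes one exchange.
\<close>

definition koszul :: "int list \<Rightarrow> nat list \<Rightarrow> real" where
  "koszul a js =
     (\<Prod>(k, l) \<in> {(k, l). k < l \<and> l < length js \<and> js ! l < js ! k}.
        ksgn (a ! (js ! k) * a ! (js ! l)))"

definition reorder :: "nat list \<Rightarrow> 'a list \<Rightarrow> 'a list" where
  "reorder js xs = map (\<lambda>i. xs ! i) js"

definition Bat :: "nat \<Rightarrow> nat \<Rightarrow> (nat \<Rightarrow> nat) set" where
  "Bat p q =
     {\<sigma>. \<sigma> permutes {..<p + q} \<and> strict_mono_on {..<p} \<sigma> \<and> strict_mono_on {p..<p + q} \<sigma>}"

definition inv_word :: "nat \<Rightarrow> (nat \<Rightarrow> nat) \<Rightarrow> nat list" where
  "inv_word n \<sigma> = map (inv \<sigma>) [0..<n]"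


section \<open>The space H and its operations\<close>

text \<open>
  A packet \<open>\<alpha>\<^sub>1 \<otimes> \<dots> \<otimes> \<alpha>\<^sub>p\<close> is the list of its (homogeneous) factors.  The space
  \<open>\<H>\<close> is the quotient of the free real vector space on packets by the span of \<open>H_relations\<close>:
  multilinearity, which yields the tensor powers of \<open>\<G>[1]\<close>, and the images of the maps
  \<open>bat\<^bsub>p,q\<^esub>\<close>.  Operations are given on packets, with values in the free space, and are
  read modulo the relations.
\<close>

type_synonym packet = "polyvec list"

definition packets :: "nat \<Rightarrow> packet set" where
  "packets d = {X. X \<noteq> [] \<and> set X \<subseteq> homs d}"

abbreviation gen :: "'g \<Rightarrow> ('g \<Rightarrow>\<^sub>0 real)" where
  "gen g \<equiv> Poly_Mapping.single g 1"

definition bat :: "nat \<Rightarrow> packet \<Rightarrow> packet \<Rightarrow> (packet \<Rightarrow>\<^sub>0 real)" where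
  "bat d X Y =
     (\<Sum>\<sigma> \<in> Bat (length X) (length Y).
        let js = inv_word (length X + length Y) \<sigma>
        in koszul (map (sdeg d) (X @ Y)) js *\<^sub>R gen (reorder js (X @ Y)))"

inductive_set H_relations :: "nat \<Rightarrow> (packet \<Rightarrow>\<^sub>0 real) set" for d :: nat where
  add: "\<lbrakk>set X \<subseteq> homs d; set Y \<subseteq> homs d; \<alpha> \<in> hom_polyvec d k; \<beta> \<in> hom_polyvec d k\<rbrakk> \<Longrightarrow>
    gen (X @ (\<alpha> + \<beta>) # Y) - gen (X @ \<alpha> # Y) - gen (X @ \<beta> # Y) \<in> H_relations d"
| scale: "\<lbrakk>set X \<subseteq> homs d; set Y \<subseteq> homs d; \<alpha> \<in> homs d\<rbrakk> \<Longrightarrow>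
    gen (X @ (c *\<^sub>R \<alpha>) # Y) - c *\<^sub>R gen (X @ \<alpha> # Y) \<in> H_relations d"
| bat: "\<lbrakk>X \<in> packets d; Y \<in> packets d\<rbrakk> \<Longrightarrow> bat d X Y \<in> H_relations d"

definition mu2 :: "nat \<Rightarrow> polyvec \<Rightarrow> polyvec \<Rightarrow> polyvec" where
  "mu2 d \<alpha> \<beta> = ksgn (sdeg d \<alpha>) *\<^sub>R wedge \<alpha> \<beta>"

definition mu :: "nat \<Rightarrow> packet \<Rightarrow> (packet \<Rightarrow>\<^sub>0 real)" where
  "mu d X =
     (\<Sum>j \<in> {j. j + 1 < length X}.
        ksgn (\<Sum>r<j. sdeg d (X ! r)) *\<^sub>R
          gen (take j X @ mu2 d (X ! j) (X ! (j + 1)) # drop (j + 2) X))"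

definition H_bracket :: "nat \<Rightarrow> packet \<Rightarrow> packet \<Rightarrow> (packet \<Rightarrow>\<^sub>0 real)" where
  "H_bracket d X Y =
     (let p = length X; q = length Y in
      \<Sum>\<sigma> \<in> Bat p q.
      \<Sum>k \<in> {k. k + 1 < p + q \<and> inv \<sigma> k < p \<and> p \<le> inv \<sigma> (k + 1)}.
        let js = inv_word (p + q) \<sigma>; Z = reorder js (X @ Y)
        in koszul (map (sdeg d) (X @ Y)) js *\<^sub>R
             gen (take k Z @ schouten d (Z ! k) (Z ! (k + 1)) # drop (k + 2) Z))"

text \<open>The degree of a packet in \<open>\<H>[1]\<close>.\<close>

definition hdeg :: "nat \<Rightarrow> packet \<Rightarrow> int" where
  "hdeg d X = (\<Sum>\<alpha>\<leftarrow>X. sdeg d \<alpha>) - 1"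


section \<open>The symmetric coalgebra\<close>

text \<open>
  A product \<open>X\<^sub>1 \<cdot> \<dots> \<cdot> X\<^sub>n\<close> of packets is the list of its factors.  The space
  \<open>S\<^sup>+(\<H>[1])\<close> is the quotient of the free real vector space on such products (with
  \<open>n \<ge> 1\<close>) by the span of \<open>S_relations\<close>: the relations of \<open>\<H>\<close> in one factor, and graded
  commutativity.  The map \<open>plug P v Q\<close> is \<open>P \<cdot> v \<cdot> Q\<close>, extended linearly in \<open>v\<close>.
\<close>

type_synonym word = "packet list"

definition plug :: "word \<Rightarrow> (packet \<Rightarrow>\<^sub>0 real) \<Rightarrow> word \<Rightarrow> (word \<Rightarrow>\<^sub>0 real)" where
  "plug P v Q = (\<Sum>X \<in> Poly_Mapping.keys v. Poly_Mapping.lookup v X *\<^sub>R gen (P @ X # Q))"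

inductive_set S_relations :: "nat \<Rightarrow> (word \<Rightarrow>\<^sub>0 real) set" for d :: nat where
  factor: "\<lbrakk>set P \<subseteq> packets d; set Q \<subseteq> packets d; v \<in> H_relations d\<rbrakk> \<Longrightarrow>
    plug P v Q \<in> S_relations d"
| comm: "\<lbrakk>set P \<subseteq> packets d; set Q \<subseteq> packets d; X \<in> packets d; Y \<in> packets d\<rbrakk> \<Longrightarrow>
    gen (P @ X # Y # Q) - ksgn (hdeg d X * hdeg d Y) *\<^sub>R gen (P @ Y # X # Q) \<in> S_relations d"

definition m_map :: "nat \<Rightarrow> word \<Rightarrow> (word \<Rightarrow>\<^sub>0 real)" where
  "m_map d W =
     (\<Sum>j<length W. ksgn (\<Sum>r<j. hdeg d (W ! r)) *\<^sub>R
        plug (take j W) (mu d (W ! j)) (drop (j + 1) W))"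

definition ell2 :: "nat \<Rightarrow> packet \<Rightarrow> packet \<Rightarrow> (packet \<Rightarrow>\<^sub>0 real)" where
  "ell2 d X Y = ksgn (hdeg d X) *\<^sub>R H_bracket d X Y"

definition ell_map :: "nat \<Rightarrow> word \<Rightarrow> (word \<Rightarrow>\<^sub>0 real)" where
  "ell_map d W =
     (\<Sum>(i, j) \<in> {(i, j). i < j \<and> j < length W}.
        let rest = filter (\<lambda>r. r \<noteq> i \<and> r \<noteq> j) [0..<length W]
        in koszul (map (hdeg d) W) (i # j # rest) *\<^sub>R
             plug [] (ell2 d (W ! i) (W ! j)) (reorder rest W))"


section \<open>The Chevalley--Harrison complex\<close>

definition words :: "nat \<Rightarrow> word set" where
  "words d = {W. W \<noteq> [] \<and> set W \<subseteq> packets d}"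

definition weight :: "word \<Rightarrow> nat" where
  "weight W = (\<Sum>X\<leftarrow>W. length X)"

definition wdeg :: "nat \<Rightarrow> word \<Rightarrow> int" where
  "wdeg d W = (\<Sum>X\<leftarrow>W. hdeg d X)"

type_synonym cochain = "(word \<Rightarrow>\<^sub>0 real) \<Rightarrow> real"

text \<open>
  A linear map on the weight \<open>N\<close> part of the quotient \<open>S\<^sup>+(\<H>[1])\<close> is a linear map on the free
  space which vanishes on the relations, extended by zero to the other generators.  For \<open>N = 0\<close>
  this is the zero space, since a word has positive weight.
\<close>

definition cochains :: "nat \<Rightarrow> nat \<Rightarrow> cochain set" where
  "cochains d N =
     {f. linear f \<and> (\<forall>r \<in> S_relations d. f r = 0) \<and>
         (\<forall>W. \<not> (W \<in> words d \<and> weight W = N) \<longrightarrow> f (gen W) = 0)}"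

definition homogeneous_cochain :: "nat \<Rightarrow> int \<Rightarrow> cochain \<Rightarrow> bool" where
  "homogeneous_cochain d k f \<longleftrightarrow> (\<forall>W. wdeg d W \<noteq> - 2 - k \<longrightarrow> f (gen W) = 0)"

definition lin_ext :: "(word \<Rightarrow> real) \<Rightarrow> cochain" where
  "lin_ext g v = (\<Sum>W \<in> Poly_Mapping.keys v. Poly_Mapping.lookup v W * g W)"

text \<open>The coboundary of a cochain \<open>f\<close> that is homogeneous of degree \<open>k\<close>.\<close>

definition dCH_hom :: "nat \<Rightarrow> int \<Rightarrow> cochain \<Rightarrow> cochain" where
  "dCH_hom d k f = lin_ext (\<lambda>W.
     if W \<in> words d then
       - (\<Sum>j \<in> {j. j < length W \<and> 2 \<le> length (W ! j)}.
            ksgn (sdeg d (hd (W ! j)) * (k + (\<Sum>i<j. hdeg d (W ! i)))) *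
            f1 (hd (W ! j)) * f (gen (W[j := tl (W ! j)])))
       - (\<Sum>j \<in> {j. j < length W \<and> 2 \<le> length (W ! j)}.
            ksgn (sdeg d (last (W ! j)) * (\<Sum>i \<in> {j<..<length W}. hdeg d (W ! i))) *
            f (gen (W[j := butlast (W ! j)])) * f1 (last (W ! j)))
       - ksgn k * f (ell_map d W + m_map d W)
     else 0)"

definition hom_component :: "nat \<Rightarrow> int \<Rightarrow> cochain \<Rightarrow> cochain" where
  "hom_component d k f = lin_ext (\<lambda>W. if wdeg d W = - 2 - k then f (gen W) else 0)"

text \<open>A cochain has finitely many nonzero homogeneous components, see
  \<open>finite_hom_components\<close> below.\<close>

definition dCH :: "nat \<Rightarrow> cochain \<Rightarrow> cochain" where
  "dCH d f = (\<lambda>v. \<Sum>k \<in> {k. hom_component d k f \<noteq> (\<lambda>_. 0)}.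
                      dCH_hom d k (hom_component d k f) v)"

definition cocycles :: "nat \<Rightarrow> nat \<Rightarrow> cochain set" where
  "cocycles d N = {f \<in> cochains d N. dCH d f = (\<lambda>_. 0)}"

text \<open>Coboundaries in \<open>C\<^sup>N\<close>, for \<open>N \<ge> 1\<close>.\<close>

definition coboundaries :: "nat \<Rightarrow> nat \<Rightarrow> cochain set" where
  "coboundaries d N = dCH d ` cochains d (N - 1)"

definition cohomologous :: "nat \<Rightarrow> nat \<Rightarrow> (cochain \<times> cochain) set" where
  "cohomologous d N =
     {(f, g). f \<in> cocycles d N \<and> g \<in> cocycles d N \<and> (\<lambda>v. f v - g v) \<in> coboundaries d N}"

definition cohomology :: "nat \<Rightarrow> nat \<Rightarrow> cochain set set" where
  "cohomology d N = cocycles d N // cohomologous d N"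

definition zero_class :: "nat \<Rightarrow> nat \<Rightarrow> cochain set" where
  "zero_class d N = cohomologous d N `` {\<lambda>_. 0}"

text \<open>The direct sum of the cohomology spaces over \<open>N \<ge> 1\<close>, and its zero element.\<close>

definition CH_cohomology :: "nat \<Rightarrow> (nat \<Rightarrow> cochain set) set" where
  "CH_cohomology d =
     {c \<in> (\<Pi>\<^sub>E N \<in> {1..}. cohomology d N). finite {N \<in> {1..}. c N \<noteq> zero_class d N}}"

definition CH_zero :: "nat \<Rightarrow> (nat \<Rightarrow> cochain set)" where
  "CH_zero d = (\<lambda>N \<in> {1..}. zero_class d N)"


section \<open>Consistency of the definition of the coboundary\<close>

lemma lookup_scaleR: "Poly_Mapping.lookup (c *\<^sub>R v) g = c *\<^sub>R Poly_Mapping.lookup v g"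
proof -
  have "finite {g. c *\<^sub>R Poly_Mapping.lookup v g \<noteq> 0}"
    by (rule finite_subset[OF _ finite_lookup[of v]]) auto
  then show ?thesis
    by (simp add: scaleR_poly_mapping_def Abs_poly_mapping_inverse)
qed

lemma poly_mapping_eq_sum_gen:
  fixes v :: "'g \<Rightarrow>\<^sub>0 real"
  shows "v = (\<Sum>g \<in> Poly_Mapping.keys v. Poly_Mapping.lookup v g *\<^sub>R gen g)"
proof (rule poly_mapping_eqI)
  fix h
  have "Poly_Mapping.lookup (\<Sum>g \<in> Poly_Mapping.keys v. Poly_Mapping.lookup v g *\<^sub>R gen g) h =
        (\<Sum>g \<in> Poly_Mapping.keys v. if h = g then Poly_Mapping.lookup v g else 0)"
    unfolding lookup_sum by (rule sum.cong) (auto simp: lookup_scaleR lookup_single when_def)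
  then show "Poly_Mapping.lookup v h =
      Poly_Mapping.lookup (\<Sum>g \<in> Poly_Mapping.keys v. Poly_Mapping.lookup v g *\<^sub>R gen g) h"
    by (simp add: in_keys_iff)
qed

lemma lin_ext_linear:
  assumes "linear f"
  shows "lin_ext (\<lambda>W. f (gen W)) = f"
proof
  fix v :: "word \<Rightarrow>\<^sub>0 real"
  have "f v = f (\<Sum>W \<in> Poly_Mapping.keys v. Poly_Mapping.lookup v W *\<^sub>R gen W)"
    using poly_mapping_eq_sum_gen[of v] by simp
  then show "lin_ext (\<lambda>W. f (gen W)) v = f v"
    by (simp add: lin_ext_def linear_sum[OF assms] linear_scale[OF assms])
qed

lemma lin_ext_zero [simp]: "lin_ext (\<lambda>W. 0) = (\<lambda>_. 0)"
  by (simp add: lin_ext_def fun_eq_iff)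

lemma cochains_0: "cochains d 0 = {\<lambda>_. 0}"
proof -
  have *: "weight W \<noteq> 0" if "W \<in> words d" for W
    using that by (cases W) (auto simp: words_def weight_def packets_def)
  show ?thesis
  proof (intro set_eqI iffI)
    fix f assume "f \<in> cochains d 0"
    then have "linear f" "\<And>W. f (gen W) = 0"
      using * by (auto simp: cochains_def)
    then show "f \<in> {\<lambda>_. 0}"
      using lin_ext_linear[of f] by simp
  qed (auto simp: cochains_def intro: linear_zero)
qed

lemma pdeg_le:
  assumes "\<alpha> \<in> homs d"
  shows "pdeg d \<alpha> \<le> d"
proof -
  obtain k where k: "\<alpha> \<in> hom_polyvec d k"
    using assms by (auto simp: homs_def)
  then have le: "pdeg d \<alpha> \<le> k"
    unfolding pdeg_def by (rule Least_le)
  show ?thesis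
  proof (cases "\<alpha> = 0")
    case True
    then have "\<alpha> \<in> hom_polyvec d 0"
      by (simp add: hom_polyvec_def)
    then have "pdeg d \<alpha> \<le> 0"
      unfolding pdeg_def by (rule Least_le)
    then show ?thesis by simp
  next
    case False
    then obtain I where "I \<in> Poly_Mapping.keys \<alpha>"
      by (metis all_not_in_conv keys_eq_empty)
    then have "I \<subseteq> {1..d}" "card I = k"
      using k by (auto simp: hom_polyvec_def)
    then have "k \<le> d"
      using card_mono[of "{1..d}" I] by simp
    then show ?thesis using le by simp
  qed
qed

lemma abs_hdeg_le:
  assumes "X \<in> packets d"
  shows "\<bar>hdeg d X\<bar> \<le> int (length X) * (int d + 2)"
proof -
  have *: "\<bar>\<Sum>\<alpha>\<leftarrow>Y. sdeg d \<alpha>\<bar> \<le> int (length Y) * (int d + 1)" if "set Y \<subseteq> homs d" for Y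
    using that
  proof (induction Y)
    case (Cons \<alpha> Y)
    then have "\<bar>sdeg d \<alpha>\<bar> \<le> int d + 1"
      using pdeg_le[of \<alpha> d] by (auto simp: sdeg_def)
    then show ?case
      using Cons by (auto simp: algebra_simps)
  qed simp
  have "length X \<ge> 1" "set X \<subseteq> homs d"
    using assms by (cases X; simp add: packets_def)+
  then show ?thesis
    using *[of X] by (simp add: hdeg_def algebra_simps)
qed

lemma abs_wdeg_le:
  assumes "set W \<subseteq> packets d"
  shows "\<bar>wdeg d W\<bar> \<le> int (weight W) * (int d + 2)"
  using assms
proof (induction W)
  case (Cons X W)
  then show ?case
    using abs_hdeg_le[of X d] by (auto simp: wdeg_def weight_def algebra_simps)
qed (simp add: wdeg_def weight_def)

lemma finite_hom_components:
  assumes "f \<in> cochains d N"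
  shows "finite {k. hom_component d k f \<noteq> (\<lambda>_. 0)}"
proof (rule finite_subset)
  let ?B = "int N * (int d + 2)"
  show "{k. hom_component d k f \<noteq> (\<lambda>_. 0)} \<subseteq> {- 2 - ?B..- 2 + ?B}"
  proof
    fix k assume "k \<in> {k. hom_component d k f \<noteq> (\<lambda>_. 0)}"
    then have "(\<lambda>W. if wdeg d W = - 2 - k then f (gen W) else 0) \<noteq> (\<lambda>W. 0)"
      by (auto simp: hom_component_def simp del: fun_eq_iff)
    then obtain W where W: "wdeg d W = - 2 - k" "f (gen W) \<noteq> 0"
      by (auto simp: fun_eq_iff split: if_splits)
    then have "W \<in> words d" "weight W = N"
      using assms by (auto simp: cochains_def)
    then have "\<bar>wdeg d W\<bar> \<le> ?B"
      using abs_wdeg_le[of W d] by (auto simp: words_def)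
    then show "k \<in> {- 2 - ?B..- 2 + ?B}"
      using W(1) by auto
  qed
qed simp

lemma hom_component_homogeneous:
  assumes "linear f" "homogeneous_cochain d k f"
  shows "hom_component d l f = (if l = k then f else (\<lambda>_. 0))"
proof -
  have "(\<lambda>W. if wdeg d W = - 2 - l then f (gen W) else 0) =
        (\<lambda>W. if l = k then f (gen W) else 0)"
    using assms(2) by (auto simp: homogeneous_cochain_def fun_eq_iff)
  then show ?thesis
    using lin_ext_linear[OF assms(1)] by (simp add: hom_component_def)
qed

lemma dCH_homogeneous:
  assumes "linear f" "homogeneous_cochain d k f"
  shows "dCH d f = dCH_hom d k f"
proof (cases "f = (\<lambda>_. 0)")
  case True
  then show ?thesis
    by (simp add: dCH_def hom_component_def dCH_hom_def if_distrib cong: if_cong)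
next
  case False
  then have "{l. hom_component d l f \<noteq> (\<lambda>_. 0)} = {k}"
    by (auto simp: hom_component_homogeneous[OF assms])
  then show ?thesis
    by (simp add: dCH_def hom_component_homogeneous[OF assms])
qed

end

theory Submission
  imports Defs
begin

text \<open>
  Since \<open>C\<^sup>0 = 0\<close>, it suffices to find a nonzero cocycle in \<open>C\<^sup>1\<close>, the dual of \<open>\<G>\<close>.  The cocycle
  condition for \<open>f\<close> says that \<open>f\<close> vanishes on Schouten brackets and is, up to signs, a derivation
  along \<open>f\<^sub>1\<close>.  The trace of linear vector fields, extended by zero to the other degrees, does
  both: a bracket has degree one only if it is the commutator of two linear vector fields or if one
  argument is a constant, and a product has degree one only if one factor is a constant.
\<close>

section \<open>Linear extension from the generators of a free space\<close>

lemma ksgn_0 [simp]: "ksgn 0 = 1"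
  by (simp add: ksgn_def)

text \<open>Supports can shrink under addition and scaling, so all sums are first taken over one
  common finite superset, where the extra terms vanish. This gives linearity of
  \<open>lin_ext\<close> and of \<open>plug\<close> in its middle argument.\<close>

lemma linear_sum_keys:
  fixes h :: "'g \<Rightarrow> 'b :: real_vector"
  shows "linear (\<lambda>v. \<Sum>g \<in> Poly_Mapping.keys v. Poly_Mapping.lookup v g *\<^sub>R h g)"
proof -
  have superset: "(\<Sum>g \<in> Poly_Mapping.keys v. Poly_Mapping.lookup v g *\<^sub>R h g) =
      (\<Sum>g \<in> A. Poly_Mapping.lookup v g *\<^sub>R h g)"
    if "finite A" "Poly_Mapping.keys v \<subseteq> A" for v :: "'g \<Rightarrow>\<^sub>0 real" and A
    using that by (intro sum.mono_neutral_left) (auto simp: in_keys_iff)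
  show ?thesis
  proof (rule linearI)
    fix v w :: "'g \<Rightarrow>\<^sub>0 real"
    define A where "A = Poly_Mapping.keys v \<union> Poly_Mapping.keys w"
    have "finite A" "Poly_Mapping.keys v \<subseteq> A" "Poly_Mapping.keys w \<subseteq> A"
      "Poly_Mapping.keys (v + w) \<subseteq> A"
      using Poly_Mapping.keys_add[of v w] by (auto simp: A_def)
    then show "(\<Sum>g \<in> Poly_Mapping.keys (v + w). Poly_Mapping.lookup (v + w) g *\<^sub>R h g) =
        (\<Sum>g \<in> Poly_Mapping.keys v. Poly_Mapping.lookup v g *\<^sub>R h g) +
        (\<Sum>g \<in> Poly_Mapping.keys w. Poly_Mapping.lookup w g *\<^sub>R h g)"
      by (simp only: superset[of A]) (simp add: lookup_add scaleR_left_distrib sum.distrib)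
  next
    fix c and v :: "'g \<Rightarrow>\<^sub>0 real"
    have "Poly_Mapping.keys (c *\<^sub>R v) \<subseteq> Poly_Mapping.keys v"
      by (auto simp: in_keys_iff lookup_scaleR)
    then show "(\<Sum>g \<in> Poly_Mapping.keys (c *\<^sub>R v). Poly_Mapping.lookup (c *\<^sub>R v) g *\<^sub>R h g) =
        c *\<^sub>R (\<Sum>g \<in> Poly_Mapping.keys v. Poly_Mapping.lookup v g *\<^sub>R h g)"
      by (subst superset[of "Poly_Mapping.keys v" "c *\<^sub>R v"])
         (simp_all add: lookup_scaleR scaleR_sum_right)
  qed
qed

lemma linear_lin_ext: "linear (lin_ext g)"
  using linear_sum_keys[of g] by (simp add: lin_ext_def[abs_def])

lemma lin_ext_gen [simp]: "lin_ext g (gen W) = g W"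
  by (simp add: lin_ext_def)

lemma linear_plug: "linear (\<lambda>v. plug P v Q)"
  unfolding plug_def by (rule linear_sum_keys)

lemma plug_gen [simp]: "plug P (gen X) Q = gen (P @ X # Q)"
  by (simp add: plug_def)


section \<open>Products and brackets of homogeneous polyvector fields\<close>

text \<open>A pair of index sets contributes to the coefficient at \<open>K\<close> exactly when it
  partitions \<open>K\<close>. The second set is then determined by the first, and the double sum
  collapses to one over the subsets of \<open>K\<close>.\<close>

lemma lookup_wedge:
  assumes "finite K"
  shows "Poly_Mapping.lookup (wedge \<alpha> \<beta>) K =
    (\<Sum>I \<in> Pow K. ksgn (int (card {(i, j). i \<in> I \<and> j \<in> K - I \<and> j < i})) *\<^sub>R
       (Poly_Mapping.lookup \<alpha> I * Poly_Mapping.lookup \<beta> (K - I)))"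
proof -
  define F where "F I J = ksgn (int (card {(i, j). i \<in> I \<and> j \<in> J \<and> j < i})) *\<^sub>R
       (Poly_Mapping.lookup \<alpha> I * Poly_Mapping.lookup \<beta> J)" for I J
  have inner: "(\<Sum>J \<in> Poly_Mapping.keys \<beta>. if I \<inter> J = {} \<and> I \<union> J = K then F I J else 0) =
      (if I \<subseteq> K then F I (K - I) else 0)" for I
  proof -
    have "(\<Sum>J \<in> Poly_Mapping.keys \<beta>. if I \<inter> J = {} \<and> I \<union> J = K then F I J else 0) =
        (\<Sum>J \<in> Poly_Mapping.keys \<beta>. if J = K - I then (if I \<subseteq> K then F I (K - I) else 0) else 0)"
      by (rule sum.cong) auto
    also have "\<dots> = (if I \<subseteq> K then F I (K - I) else 0)"
      by (simp add: F_def in_keys_iff)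
    finally show ?thesis .
  qed
  have "Poly_Mapping.lookup (wedge \<alpha> \<beta>) K =
    (\<Sum>I \<in> Poly_Mapping.keys \<alpha>. \<Sum>J \<in> Poly_Mapping.keys \<beta>.
       if I \<inter> J = {} \<and> I \<union> J = K then F I J else 0)"
    unfolding wedge_def lookup_sum
    by (intro sum.cong refl) (auto simp: F_def lookup_scaleR lookup_single when_def)
  also have "\<dots> = (\<Sum>I \<in> Poly_Mapping.keys \<alpha>. if I \<subseteq> K then F I (K - I) else 0)"
    by (simp only: inner)
  also have "\<dots> = (\<Sum>I \<in> Poly_Mapping.keys \<alpha> \<inter> Pow K. F I (K - I))"
    by (simp add: sum.inter_restrict Pow_def)
  also have "\<dots> = (\<Sum>I \<in> Pow K. F I (K - I))"
    using assms by (intro sum.mono_neutral_left) (auto simp: F_def in_keys_iff)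
  finally show ?thesis by (simp add: F_def)
qed

text \<open>A singleton splits only trivially and without inversions, so no sign appears. Singleton
  coefficients are the only ones that the trace reads.\<close>

lemma lookup_wedge_singleton:
  "Poly_Mapping.lookup (wedge \<alpha> \<beta>) {i} =
     Poly_Mapping.lookup \<alpha> {} * Poly_Mapping.lookup \<beta> {i} +
     Poly_Mapping.lookup \<alpha> {i} * Poly_Mapping.lookup \<beta> {}"
proof -
  have empty: "{(a, b). a = i \<and> b = i \<and> b \<noteq> i \<and> b < a} = {}"
    by auto
  show ?thesis
    by (simp add: lookup_wedge Pow_insert empty)
qed

lemma pderiv_mpoly_0 [simp]: "pderiv_mpoly i 0 = 0"
  by (simp add: pderiv_mpoly_def)

lemma lookup_pderiv_polyvec:
  "Poly_Mapping.lookup (pderiv_polyvec i \<alpha>) I = pderiv_mpoly i (Poly_Mapping.lookup \<alpha> I)"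
proof -
  have "Poly_Mapping.lookup (pderiv_polyvec i \<alpha>) I =
      (\<Sum>J \<in> Poly_Mapping.keys \<alpha>. if I = J then pderiv_mpoly i (Poly_Mapping.lookup \<alpha> J) else 0)"
    unfolding pderiv_polyvec_def lookup_sum
    by (rule sum.cong) (auto simp: lookup_single when_def)
  then show ?thesis
    by (simp add: in_keys_iff)
qed

text \<open>Deleting \<open>i\<close> leaves the empty set only for \<open>{i}\<close> itself, where
  nothing has to be passed; the left and right derivatives therefore agree here.\<close>

lemma lookup_odd_deriv_empty:
  "Poly_Mapping.lookup (right_odd_deriv i \<alpha>) {} = Poly_Mapping.lookup \<alpha> {i}"
  "Poly_Mapping.lookup (left_odd_deriv i \<alpha>) {} = Poly_Mapping.lookup \<alpha> {i}"
proof -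
  have sgn: "ksgn (int (card {j \<in> {i}. i < j})) = 1" "ksgn (int (card {j \<in> {i}. j < i})) = 1"
    by (simp_all add: ksgn_def conj_commute cong: conj_cong)
  have sum: "(\<Sum>I \<in> {I \<in> Poly_Mapping.keys \<alpha>. i \<in> I}. c I *\<^sub>R
          Poly_Mapping.lookup (Poly_Mapping.single (I - {i}) (Poly_Mapping.lookup \<alpha> I)) {}) =
      Poly_Mapping.lookup \<alpha> {i}" if "c {i} = 1" for c :: "nat set \<Rightarrow> real"
  proof -
    have "(\<Sum>I \<in> {I \<in> Poly_Mapping.keys \<alpha>. i \<in> I}. c I *\<^sub>R
          Poly_Mapping.lookup (Poly_Mapping.single (I - {i}) (Poly_Mapping.lookup \<alpha> I)) {}) =
        (\<Sum>I \<in> {I \<in> Poly_Mapping.keys \<alpha>. i \<in> I}. if I = {i} then Poly_Mapping.lookup \<alpha> {i} else 0)"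
      using that by (intro sum.cong) (auto simp: lookup_single when_def)
    then show ?thesis
      by (simp add: in_keys_iff)
  qed
  show "Poly_Mapping.lookup (right_odd_deriv i \<alpha>) {} = Poly_Mapping.lookup \<alpha> {i}"
    unfolding right_odd_deriv_def lookup_sum lookup_scaleR by (rule sum) (rule sgn)
  show "Poly_Mapping.lookup (left_odd_deriv i \<alpha>) {} = Poly_Mapping.lookup \<alpha> {i}"
    unfolding left_odd_deriv_def lookup_sum lookup_scaleR by (rule sum) (rule sgn)
qed

section \<open>Closure of homogeneous elements under sums, scalars and products\<close>

lemma homogeneous_mpoly_mult:
  assumes p: "homogeneous_mpoly d k p" and q: "homogeneous_mpoly d l q"
  shows "homogeneous_mpoly d (k + l) (p * q)"
  unfolding homogeneous_mpoly_def
proof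
  fix m assume "m \<in> Poly_Mapping.keys (p * q)"
  then obtain a b where m: "m = a + b" and a: "a \<in> Poly_Mapping.keys p"
      and b: "b \<in> Poly_Mapping.keys q"
    using keys_mult[of p q] by auto
  have keys: "Poly_Mapping.keys a \<subseteq> {1..d}" "Poly_Mapping.keys b \<subseteq> {1..d}"
    using p q a b by (auto simp: homogeneous_mpoly_def)
  then have keys_m: "Poly_Mapping.keys m \<subseteq> {1..d}"
    using Poly_Mapping.keys_add[of a b] unfolding m by blast
  \<comment> \<open>Over the fixed range \<open>{1..d}\<close>, instead of the varying support, the
    total degree is visibly additive in the exponent.\<close>
  have sum: "(\<Sum>i \<in> Poly_Mapping.keys n. Poly_Mapping.lookup n i) = (\<Sum>i = 1..d. Poly_Mapping.lookup n i)"
    if "Poly_Mapping.keys n \<subseteq> {1..d}" for n :: "nat \<Rightarrow>\<^sub>0 nat"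
    using that by (intro sum.mono_neutral_left) (auto simp: in_keys_iff)
  have "(\<Sum>i = 1..d. Poly_Mapping.lookup a i) = k" "(\<Sum>i = 1..d. Poly_Mapping.lookup b i) = l"
    using p q a b sum[OF keys(1)] sum[OF keys(2)] by (auto simp: homogeneous_mpoly_def)
  then show "Poly_Mapping.keys m \<subseteq> {1..d} \<and>
      (\<Sum>i \<in> Poly_Mapping.keys m. Poly_Mapping.lookup m i) = k + l"
    using keys_m sum[OF keys_m] by (simp add: m lookup_add sum.distrib)
qed

lemma hom_polyvec_add:
  assumes "\<alpha> \<in> hom_polyvec d k" "\<beta> \<in> hom_polyvec d k"
  shows "\<alpha> + \<beta> \<in> hom_polyvec d k"
proof -
  \<comment> \<open>Index sets outside the support are included, since the zero polynomial is
    homogeneous of every degree. An index in the support of only one summand then needs no separate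
    case.\<close>
  have *: "homogeneous_mpoly d k (Poly_Mapping.lookup \<gamma> I)" if "\<gamma> \<in> hom_polyvec d k" for \<gamma> I
    using that by (cases "I \<in> Poly_Mapping.keys \<gamma>")
      (auto simp: hom_polyvec_def homogeneous_mpoly_def in_keys_iff)
  have "homogeneous_mpoly d k (p + q)" if "homogeneous_mpoly d k p" "homogeneous_mpoly d k q" for p q
    using that Poly_Mapping.keys_add[of p q] unfolding homogeneous_mpoly_def by blast
  then have "homogeneous_mpoly d k (Poly_Mapping.lookup (\<alpha> + \<beta>) I)" for I
    using *[OF assms(1)] *[OF assms(2)] by (simp add: lookup_add)
  moreover have "I \<subseteq> {1..d} \<and> card I = k" if "I \<in> Poly_Mapping.keys (\<alpha> + \<beta>)" for I
    using that assms Poly_Mapping.keys_add[of \<alpha> \<beta>] unfolding hom_polyvec_def by blast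
  ultimately show ?thesis
    unfolding hom_polyvec_def by blast
qed

lemma hom_polyvec_scaleR:
  assumes "\<alpha> \<in> hom_polyvec d k"
  shows "c *\<^sub>R \<alpha> \<in> hom_polyvec d k"
proof -
  have keys: "Poly_Mapping.keys (c *\<^sub>R v) \<subseteq> Poly_Mapping.keys v"
    for v :: "'g \<Rightarrow>\<^sub>0 'b :: real_vector"
    by (auto simp: in_keys_iff lookup_scaleR)
  have "homogeneous_mpoly d k (c *\<^sub>R p)" if "homogeneous_mpoly d k p" for p
    using that keys[of p] unfolding homogeneous_mpoly_def by blast
  then show ?thesis
    using assms keys[of \<alpha>] unfolding hom_polyvec_def by (auto simp only: lookup_scaleR)
qed

lemma hom_polyvec_sum:
  assumes "\<And>x. x \<in> A \<Longrightarrow> \<gamma> x \<in> hom_polyvec d k"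
  shows "sum \<gamma> A \<in> hom_polyvec d k"
  using assms
proof (induction A rule: infinite_finite_induct)
  case (insert x A)
  then show ?case
    by (auto intro: hom_polyvec_add)
qed (simp_all add: hom_polyvec_def)

lemma hom_polyvec_wedge:
  assumes "\<alpha> \<in> hom_polyvec d k" "\<beta> \<in> hom_polyvec d l"
  shows "wedge \<alpha> \<beta> \<in> hom_polyvec d (k + l)"
  unfolding wedge_def
proof (intro hom_polyvec_sum)
  fix I J assume "I \<in> Poly_Mapping.keys \<alpha>" "J \<in> Poly_Mapping.keys \<beta>"
  then have I: "I \<subseteq> {1..d}" "card I = k" "homogeneous_mpoly d k (Poly_Mapping.lookup \<alpha> I)"
    and J: "J \<subseteq> {1..d}" "card J = l" "homogeneous_mpoly d l (Poly_Mapping.lookup \<beta> J)"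
    using assms by (auto simp: hom_polyvec_def)
  have "card (I \<union> J) = k + l" if "I \<inter> J = {}"
    using I(1,2) J(1,2) that by (auto simp: card_Un_disjoint finite_subset)
  then have "Poly_Mapping.single (I \<union> J) (Poly_Mapping.lookup \<alpha> I * Poly_Mapping.lookup \<beta> J)
      \<in> hom_polyvec d (k + l)" if "I \<inter> J = {}"
    using I(1) J(1) that homogeneous_mpoly_mult[OF I(3) J(3)]
    by (simp add: hom_polyvec_def)
  then show "(if I \<inter> J = {}
        then ksgn (int (card {(i, j). i \<in> I \<and> j \<in> J \<and> j < i})) *\<^sub>R
               Poly_Mapping.single (I \<union> J) (Poly_Mapping.lookup \<alpha> I * Poly_Mapping.lookup \<beta> J)
        else 0) \<in> hom_polyvec d (k + l)"
    by (auto intro: hom_polyvec_scaleR) (simp add: hom_polyvec_def)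
qed

text \<open>Degrees add under the wedge product. The trace cochain is nonzero only on words with
  homogeneous factors, so evaluating it on a product requires this closure.\<close>

lemma mu2_in_homs:
  assumes "\<alpha> \<in> homs d" "\<beta> \<in> homs d"
  shows "mu2 d \<alpha> \<beta> \<in> homs d"
proof -
  obtain k l where "\<alpha> \<in> hom_polyvec d k" "\<beta> \<in> hom_polyvec d l"
    using assms by (auto simp: homs_def)
  then have "mu2 d \<alpha> \<beta> \<in> hom_polyvec d (k + l)"
    unfolding mu2_def by (intro hom_polyvec_scaleR hom_polyvec_wedge)
  then show ?thesis
    by (auto simp: homs_def)
qed

text \<open>The polynomial degree is read off \<open>I\<close> rather than off \<alpha>, so that
  later arguments need no case distinction on the degree of \<alpha>.\<close>

lemma homs_lookup:
  assumes "\<alpha> \<in> homs d"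
  shows "homogeneous_mpoly d (card I) (Poly_Mapping.lookup \<alpha> I)"
proof (cases "I \<in> Poly_Mapping.keys \<alpha>")
  case True
  then show ?thesis
    using assms by (auto simp: homs_def hom_polyvec_def)
next
  case False
  then show ?thesis
    by (simp add: in_keys_iff homogeneous_mpoly_def)
qed

section \<open>Constant and linear coefficients\<close>

lemma homogeneous_mpoly_0:
  assumes "homogeneous_mpoly d 0 p"
  shows "p = Poly_Mapping.single 0 (Poly_Mapping.lookup p 0)"
proof (rule poly_mapping_eqI)
  fix m
  have "m = 0" if "m \<in> Poly_Mapping.keys p"
    using assms that by (intro poly_mapping_eqI) (auto simp: homogeneous_mpoly_def in_keys_iff)
  then show "Poly_Mapping.lookup p m =
      Poly_Mapping.lookup (Poly_Mapping.single 0 (Poly_Mapping.lookup p 0)) m"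
    by (auto simp: lookup_single when_def in_keys_iff)
qed

text \<open>In degree at most one, the only monomial that involves the variable of index
  \<open>i\<close> is that variable itself, and its derivative is a constant.\<close>

lemma pderiv_homogeneous_mpoly:
  assumes "homogeneous_mpoly d k p" "k \<le> 1"
  shows "pderiv_mpoly i p =
    Poly_Mapping.single 0 (Poly_Mapping.lookup p (Poly_Mapping.single i 1))"
proof -
  let ?x = "Poly_Mapping.single i 1 :: nat \<Rightarrow>\<^sub>0 nat"
  have m: "m = ?x" if "m \<in> Poly_Mapping.keys p" "Poly_Mapping.lookup m i \<noteq> 0" for m
  proof -
    have i: "i \<in> Poly_Mapping.keys m"
      using that by (simp add: in_keys_iff)
    \<comment> \<open>The exponent at \<open>i\<close> is positive and the total is at most one, so
      the exponent at \<open>i\<close> is 1 and all others vanish.\<close>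
    have "Poly_Mapping.lookup m i + (\<Sum>j \<in> Poly_Mapping.keys m - {i}. Poly_Mapping.lookup m j) =
        (\<Sum>j \<in> Poly_Mapping.keys m. Poly_Mapping.lookup m j)"
      using i by (simp add: sum.remove)
    also have "\<dots> \<le> 1"
      using assms that by (auto simp: homogeneous_mpoly_def)
    finally have "Poly_Mapping.lookup m i = 1"
      "(\<Sum>j \<in> Poly_Mapping.keys m - {i}. Poly_Mapping.lookup m j) = 0"
      using that by linarith+
    then have "Poly_Mapping.lookup m j = (if j = i then 1 else 0)" for j
      by (auto simp: in_keys_iff)
    then show ?thesis
      by (intro poly_mapping_eqI) (auto simp: lookup_single when_def)
  qed
  have "pderiv_mpoly i p = (\<Sum>m \<in> Poly_Mapping.keys p.
      if m = ?x then Poly_Mapping.single 0 (Poly_Mapping.lookup p ?x) else 0)"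
    unfolding pderiv_mpoly_def
  proof (rule sum.cong)
    fix m assume "m \<in> Poly_Mapping.keys p"
    then show "Poly_Mapping.single (m - ?x)
          (of_nat (Poly_Mapping.lookup m i) * Poly_Mapping.lookup p m) =
        (if m = ?x then Poly_Mapping.single 0 (Poly_Mapping.lookup p ?x) else 0)"
      using m[of m] by (cases "Poly_Mapping.lookup m i = 0") auto
  qed simp
  then show ?thesis
    by (simp add: in_keys_iff)
qed

lemma pderiv_homogeneous_mpoly_0:
  assumes "homogeneous_mpoly d 0 p"
  shows "pderiv_mpoly i p = 0"
proof -
  have "Poly_Mapping.lookup p (Poly_Mapping.single i 1) = 0"
    by (subst homogeneous_mpoly_0[OF assms])
       (metis lookup_single_eq lookup_single_not_eq lookup_zero one_neq_zero)
  then show ?thesis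
    using pderiv_homogeneous_mpoly[OF assms, of i] by simp
qed

lemma lookup_const_mult:
  fixes p :: mpoly
  shows "Poly_Mapping.lookup (Poly_Mapping.single 0 c * p) m = c * Poly_Mapping.lookup p m"
  \<comment> \<open>Multiplication by a constant is the coefficientwise \<open>map\<close>, whose
    coefficients are immediate.\<close>
  by (simp add: map.rep_eq when_def flip: mult_map_scale_conv_mult)

lemma lookup_mult_const:
  fixes p :: mpoly
  shows "Poly_Mapping.lookup (p * Poly_Mapping.single 0 c) m = Poly_Mapping.lookup p m * c"
  using lookup_const_mult[of c p m] by (simp add: mult.commute)

text \<open>For a linear vector field this is the trace of its coefficient matrix, equivalently its
  divergence. Only singleton index sets are read, so homogeneous elements of degree other than one
  have trace 0.\<close>

definition vf_trace :: "nat \<Rightarrow> polyvec \<Rightarrow> real" where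
  "vf_trace d \<alpha> =
     (\<Sum>i = 1..d. Poly_Mapping.lookup (Poly_Mapping.lookup \<alpha> {i}) (Poly_Mapping.single i 1))"

lemma vf_trace_add: "vf_trace d (\<alpha> + \<beta>) = vf_trace d \<alpha> + vf_trace d \<beta>"
  by (simp add: vf_trace_def lookup_add sum.distrib)

lemma vf_trace_scaleR: "vf_trace d (c *\<^sub>R \<alpha>) = c * vf_trace d \<alpha>"
  by (simp add: vf_trace_def lookup_scaleR sum_distrib_left)

text \<open>The degree one part of a product pairs a degree zero part with a degree one part. Degree
  zero coefficients are the constants given by \<open>f1\<close>, so they can be pulled out of the
  trace.\<close>

lemma vf_trace_wedge:
  assumes "\<alpha> \<in> homs d" "\<beta> \<in> homs d"
  shows "vf_trace d (wedge \<alpha> \<beta>) = f1 \<alpha> * vf_trace d \<beta> + vf_trace d \<alpha> * f1 \<beta>"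
proof -
  have const: "Poly_Mapping.lookup \<gamma> {} = Poly_Mapping.single 0 (f1 \<gamma>)" if "\<gamma> \<in> homs d" for \<gamma>
    unfolding f1_def using homs_lookup[OF that, of "{}"] by (intro homogeneous_mpoly_0) simp
  show ?thesis
    by (simp add: vf_trace_def lookup_wedge_singleton const[OF assms(1)] const[OF assms(2)]
        lookup_add lookup_const_mult lookup_mult_const sum.distrib sum_distrib_left
        sum_distrib_right)
qed

text \<open>What survives in the singleton coefficients is the commutator of the two coefficient
  matrices, and a commutator has trace zero.\<close>

lemma vf_trace_schouten:
  assumes "\<alpha> \<in> homs d" "\<beta> \<in> homs d"
  shows "vf_trace d (schouten d \<alpha> \<beta>) = 0"
proof -
  define c where "c \<gamma> i j = Poly_Mapping.lookup (Poly_Mapping.lookup \<gamma> {i}) (Poly_Mapping.single j 1)"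
    for \<gamma> :: polyvec and i j
  \<comment> \<open>Degree zero elements are constants, so their derivatives vanish. This removes
    the terms that pair a bivector coefficient with a function, the only other source of degree
    one.\<close>
  have pderiv_empty: "Poly_Mapping.lookup (pderiv_polyvec i \<gamma>) {} = 0" if "\<gamma> \<in> homs d" for \<gamma> i
    using homs_lookup[OF that, of "{}"]
    by (simp add: lookup_pderiv_polyvec pderiv_homogeneous_mpoly_0)
  have pderiv_linear: "Poly_Mapping.lookup (pderiv_polyvec i \<gamma>) {j} =
      Poly_Mapping.single 0 (c \<gamma> j i)" if "\<gamma> \<in> homs d" for \<gamma> i j
    using homs_lookup[OF that, of "{j}"]
    by (simp add: lookup_pderiv_polyvec pderiv_homogeneous_mpoly c_def)
  have "vf_trace d (schouten d \<alpha> \<beta>) =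
      (\<Sum>j = 1..d. \<Sum>i = 1..d. c \<alpha> i j * c \<beta> j i - c \<alpha> j i * c \<beta> i j)"
    by (simp add: vf_trace_def schouten_def c_def lookup_sum lookup_minus lookup_wedge_singleton
        lookup_odd_deriv_empty pderiv_empty[OF assms(1)] pderiv_empty[OF assms(2)]
        pderiv_linear[OF assms(1), unfolded c_def] pderiv_linear[OF assms(2), unfolded c_def]
        lookup_const_mult lookup_mult_const)
  \<comment> \<open>Exchanging the two summations is the identity tr(AB) = tr(BA).\<close>
  also have "\<dots> = 0"
    using sum.swap[of "\<lambda>j i. c \<alpha> i j * c \<beta> j i" "{1..d}" "{1..d}"]
    by (simp add: sum_subtractf)
  finally show ?thesis .
qed

text \<open>A nonzero trace needs a nonzero singleton coefficient, which forces degree one. This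
  fixes the degree of the trace cochain and removes a sign in the cocycle equation.\<close>

lemma sdeg_vf_trace:
  assumes "\<alpha> \<in> homs d" "vf_trace d \<alpha> \<noteq> 0"
  shows "sdeg d \<alpha> = 0"
proof -
  obtain i where "Poly_Mapping.lookup \<alpha> {i} \<noteq> 0"
  proof (rule ccontr)
    assume "\<not> thesis"
    then have "Poly_Mapping.lookup \<alpha> {i} = 0" for i
      using that by blast
    then show False
      using assms(2) by (simp add: vf_trace_def)
  qed
  then have i: "{i} \<in> Poly_Mapping.keys \<alpha>"
    by (simp add: in_keys_iff)
  then have deg: "k = 1" if "\<alpha> \<in> hom_polyvec d k" for k
    using that by (auto simp: hom_polyvec_def)
  obtain k where "\<alpha> \<in> hom_polyvec d k"
    using assms(1) by (auto simp: homs_def)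
  then have "\<alpha> \<in> hom_polyvec d (pdeg d \<alpha>)"
    unfolding pdeg_def by (rule LeastI)
  from deg[OF this] show ?thesis
    by (simp add: sdeg_def)
qed


section \<open>The trace cocycle\<close>

text \<open>A word of weight 1 is a single packet with a single factor, which
  \<open>hd (hd W)\<close> extracts. The value 0 on all other generators is what membership in
  \<open>cochains d 1\<close> demands.\<close>

definition trace_word :: "nat \<Rightarrow> word \<Rightarrow> real" where
  "trace_word d W =
     (if W \<in> words d \<and> weight W = 1 then vf_trace d (hd (hd W)) else 0)"

definition trace_cochain :: "nat \<Rightarrow> cochain" where
  "trace_cochain d = lin_ext (trace_word d)"

lemma linear_trace_cochain: "linear (trace_cochain d)"
  by (simp add: trace_cochain_def linear_lin_ext)

lemma trace_cochain_gen [simp]: "trace_cochain d (gen W) = trace_word d W"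
  by (simp add: trace_cochain_def)

lemma trace_cochain_plug:
  "trace_cochain d (plug P v Q) =
     (\<Sum>X \<in> Poly_Mapping.keys v. Poly_Mapping.lookup v X * trace_word d (P @ X # Q))"
  by (simp add: plug_def linear_sum[OF linear_trace_cochain] linear_scale[OF linear_trace_cochain])

lemma trace_word_single:
  "trace_word d [[\<alpha>]] = (if \<alpha> \<in> homs d then vf_trace d \<alpha> else 0)"
  by (simp add: trace_word_def words_def packets_def weight_def)

text \<open>Packets are nonempty, so each adds at least 1 to the weight; weight 1 leaves room for
  one packet with one factor. Vanishing proofs thereby reduce to counting packets and
  factors.\<close>

lemma trace_word_nonzeroE:
  assumes "trace_word d W \<noteq> 0"
  obtains \<alpha> where "W = [[\<alpha>]]" "\<alpha> \<in> homs d" "vf_trace d \<alpha> \<noteq> 0"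
proof -
  have W: "W \<in> words d" "weight W = 1" "vf_trace d (hd (hd W)) \<noteq> 0"
    using assms by (auto simp: trace_word_def split: if_splits)
  then obtain X W' where W': "W = X # W'" "X \<in> packets d" "set W' \<subseteq> packets d"
    by (cases W) (auto simp: words_def)
  moreover from W' obtain \<alpha> X' where X: "X = \<alpha> # X'" "\<alpha> \<in> homs d"
    by (cases X) (auto simp: packets_def)
  ultimately have "X' = []" "weight W' = 0"
    using W(2) by (auto simp: weight_def)
  moreover have "W' = []"
    using \<open>weight W' = 0\<close> W'(3) by (cases W') (auto simp: weight_def packets_def)
  ultimately show thesis
    using that W' X W(3) by auto
qed

lemma trace_word_eq_0:
  assumes "\<And>\<alpha>. W \<noteq> [[\<alpha>]]"
  shows "trace_word d W = 0"
  using assms by (meson trace_word_nonzeroE)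

lemma trace_cochain_plug_eq_0:
  assumes "P @ Q \<noteq> []"
  shows "trace_cochain d (plug P v Q) = 0"
  unfolding trace_cochain_plug
  using assms by (intro sum.neutral ballI) (auto intro!: trace_word_eq_0 simp: append_eq_Cons_conv)

section \<open>Compatibility with the relations, and the degree\<close>

lemma length_inv_word [simp]: "length (inv_word n \<sigma>) = n"
  by (simp add: inv_word_def)

lemma length_reorder [simp]: "length (reorder js xs) = length js"
  by (simp add: reorder_def)

lemma linear_trace_plug: "linear (\<lambda>v. trace_cochain d (plug P v Q))"
  using linear_compose[OF linear_plug linear_trace_cochain] by (simp add: o_def)

text \<open>Multilinearity relations in a packet with one factor hold because the trace is linear.
  All remaining relations involve only packets with at least two factors, which the cochain does not
  see.\<close>

lemma trace_cochain_H_relations: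
  assumes "v \<in> H_relations d"
  shows "trace_cochain d (plug [] v []) = 0"
  using assms
proof cases
  case (add X Y \<alpha> k \<beta>)
  note lin = linear_diff[OF linear_trace_plug]
  show ?thesis
  proof (cases "X = [] \<and> Y = []")
    case True
    have "\<alpha> \<in> homs d" "\<beta> \<in> homs d" "\<alpha> + \<beta> \<in> homs d"
      using add hom_polyvec_add[of \<alpha> d k \<beta>] by (auto simp: homs_def)
    then show ?thesis
      using True by (simp add: add lin trace_word_single vf_trace_add)
  next
    case False
    then have "trace_word d [X @ \<gamma> # Y] = 0" for \<gamma>
      by (intro trace_word_eq_0) (auto simp: append_eq_Cons_conv)
    then show ?thesis
      by (simp add: add lin)
  qed
next
  case (scale X Y \<alpha> c)
  note lin = linear_diff[OF linear_trace_plug] linear_scale[OF linear_trace_plug]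
  show ?thesis
  proof (cases "X = [] \<and> Y = []")
    case True
    have "c *\<^sub>R \<alpha> \<in> homs d"
      using scale(4) by (auto simp: homs_def intro: hom_polyvec_scaleR)
    then show ?thesis
      using True scale(4) by (simp add: scale(1) lin trace_word_single vf_trace_scaleR)
  next
    case False
    then have "trace_word d [X @ \<gamma> # Y] = 0" for \<gamma>
      by (intro trace_word_eq_0) (auto simp: append_eq_Cons_conv)
    then show ?thesis
      by (simp add: scale(1) lin)
  qed
next
  case (bat X Y)
  \<comment> \<open>Both packets are nonempty, so every shuffle has at least two factors.\<close>
  have "length X + length Y \<noteq> 1"
    using bat by (cases X; cases Y) (auto simp: packets_def)
  then have "trace_word d [reorder (inv_word (length X + length Y) \<sigma>) (X @ Y)] = 0" for \<sigma>
    by (intro trace_word_eq_0) (auto dest: arg_cong[where f = length])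
  then show ?thesis
    by (simp add: bat(1) bat_def Let_def linear_sum[OF linear_trace_plug]
        linear_scale[OF linear_trace_plug])
qed

text \<open>Relations with a nonempty context, and graded commutativity, involve only products of at
  least two packets. Only the relations of a lone packet remain.\<close>

lemma trace_cochain_in_cochains: "trace_cochain d \<in> cochains d 1"
proof -
  have "trace_cochain d r = 0" if "r \<in> S_relations d" for r
    using that
  proof cases
    case (factor P Q v)
    then show ?thesis
      using trace_cochain_H_relations trace_cochain_plug_eq_0[of P Q]
      by (cases "P @ Q = []") auto
  next
    case (comm P Q X Y)
    have "trace_word d (P @ Z # Z' # Q) = 0" for Z Z'
      by (rule trace_word_eq_0) (auto simp: append_eq_Cons_conv)
    then show ?thesis
      by (simp add: comm(1) linear_diff[OF linear_trace_cochain]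
          linear_scale[OF linear_trace_cochain])
  qed
  then show ?thesis
    using linear_trace_cochain by (auto simp: cochains_def trace_word_def)
qed

text \<open>On its support the factor has degree a = 0 in the shifted grading, so the packet has
  degree -1, which equals -2 - |f| for |f| = -1.\<close>

lemma trace_cochain_homogeneous: "homogeneous_cochain d (-1) (trace_cochain d)"
  unfolding homogeneous_cochain_def
proof (intro allI impI)
  fix W assume "wdeg d W \<noteq> - 2 - (-1)"
  then show "trace_cochain d (gen W) = 0"
    by (auto elim!: trace_word_nonzeroE simp: wdeg_def hdeg_def sdeg_vf_trace intro: ccontr)
qed

section \<open>The coboundary of the trace cochain\<close>

lemma trace_cochain_m_map:
  assumes "\<And>\<alpha> \<beta>. W \<noteq> [[\<alpha>, \<beta>]]"
  shows "trace_cochain d (m_map d W) = 0"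
proof -
  have "trace_cochain d (plug (take j W) (mu d (W ! j)) (drop (j + 1) W)) = 0"
    if j: "j < length W" for j
  proof (cases "take j W @ drop (j + 1) W = []")
    case True
    then obtain X where W: "W = [X]" "j = 0"
      using j by (cases W) auto
    \<comment> \<open>\<open>mu\<close> merges two neighbouring factors, so a single factor remains
      only from a packet of length 2, which the hypothesis excludes.\<close>
    have "trace_word d [take i X @ mu2 d (X ! i) (X ! (i + 1)) # drop (i + 2) X] = 0"
      if "i + 1 < length X" for i
    proof (rule trace_word_eq_0, rule notI)
      fix \<alpha> assume "[take i X @ mu2 d (X ! i) (X ! (i + 1)) # drop (i + 2) X] = [[\<alpha>]]"
      then have "length X = 2"
        using that by (auto simp: append_eq_Cons_conv)
      then show False
        using assms W by (auto simp: length_Suc_conv numeral_2_eq_2)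
    qed
    then show ?thesis
      by (simp add: W mu_def linear_sum[OF linear_trace_plug] linear_scale[OF linear_trace_plug])
  qed (rule trace_cochain_plug_eq_0)
  then show ?thesis
    by (simp add: m_map_def linear_sum[OF linear_trace_cochain] linear_scale[OF linear_trace_cochain])
qed

text \<open>Packets of lengths p and q give packets of length p + q - 1. Only p = q = 1 leaves a
  single factor, and that factor is a Schouten bracket, whose trace is zero.\<close>

lemma trace_cochain_H_bracket:
  assumes "X \<in> packets d" "Y \<in> packets d"
  shows "trace_cochain d (plug [] (H_bracket d X Y) []) = 0"
proof -
  let ?p = "length X" and ?q = "length Y"
  have "trace_word d [take k Z @ schouten d (Z ! k) (Z ! (k + 1)) # drop (k + 2) Z] = 0"
    if "\<sigma> \<in> Bat ?p ?q" "k + 1 < ?p + ?q" "Z = reorder (inv_word (?p + ?q) \<sigma>) (X @ Y)" for \<sigma> k Z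
  proof (cases "?p + ?q = 2")
    case True
    have "\<sigma> permutes {..<?p + ?q}"
      using that by (simp add: Bat_def)
    then have "Z ! i \<in> homs d" if "i < ?p + ?q" for i
    proof -
      have "inv \<sigma> i < ?p + ?q"
        using permutes_in_image[OF permutes_inv[OF \<open>\<sigma> permutes _\<close>], of i] that by simp
      then have "(X @ Y) ! inv \<sigma> i \<in> set (X @ Y)"
        by (intro nth_mem) simp
      then show ?thesis
        using assms that \<open>Z = _\<close> by (auto simp: packets_def reorder_def inv_word_def)
    qed
    then have "vf_trace d (schouten d (Z ! k) (Z ! (k + 1))) = 0"
      using that by (intro vf_trace_schouten) auto
    \<comment> \<open>Both branches of \<open>trace_word_single\<close> give 0 here.\<close>
    then show ?thesis
      using True that by (simp add: trace_word_single)
  next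
    case False
    then show ?thesis
      using that by (intro trace_word_eq_0) (auto dest!: arg_cong[where f = length])
  qed
  then show ?thesis
    by (simp add: H_bracket_def Let_def linear_sum[OF linear_trace_plug]
        linear_scale[OF linear_trace_plug])
qed

text \<open>The packets outside the bracketed pair stay as further packets, so only a word of
  exactly two packets could contribute; there the bracket itself has trace zero.\<close>

lemma trace_cochain_ell_map:
  assumes "set W \<subseteq> packets d"
  shows "trace_cochain d (ell_map d W) = 0"
proof -
  have "trace_cochain d (plug [] (ell2 d (W ! i) (W ! j)) Q) = 0" if "i < j" "j < length W" for i j Q
  proof (cases "Q = []")
    case True
    have "W ! i \<in> packets d" "W ! j \<in> packets d"
      using that assms by (auto intro!: subsetD[OF assms])
    then show ?thesis
      by (simp add: True ell2_def linear_scale[OF linear_trace_plug] trace_cochain_H_bracket)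
  qed (simp add: trace_cochain_plug_eq_0)
  then show ?thesis
    by (simp add: ell_map_def linear_sum[OF linear_trace_cochain] Let_def case_prod_unfold
        linear_scale[OF linear_trace_cochain])
qed

text \<open>The only words that matter are \<open>[[\<alpha>, \<beta>]]\<close>, where the condition
  is the derivation rule for the trace of a product up to signs. On any other word each term
  vanishes, by shape or because brackets have trace zero.\<close>

lemma dCH_trace_cochain: "dCH d (trace_cochain d) = (\<lambda>_. 0)"
proof -
  let ?f = "trace_cochain d"
  have "- (\<Sum>j \<in> {j. j < length W \<and> 2 \<le> length (W ! j)}.
            ksgn (sdeg d (hd (W ! j)) * (-1 + (\<Sum>i<j. hdeg d (W ! i)))) *
            f1 (hd (W ! j)) * ?f (gen (W[j := tl (W ! j)])))
       - (\<Sum>j \<in> {j. j < length W \<and> 2 \<le> length (W ! j)}.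
            ksgn (sdeg d (last (W ! j)) * (\<Sum>i \<in> {j<..<length W}. hdeg d (W ! i))) *
            ?f (gen (W[j := butlast (W ! j)])) * f1 (last (W ! j)))
       - ksgn (-1) * ?f (ell_map d W + m_map d W) = 0" (is "- ?A - ?B - ?C = 0")
    if W: "W \<in> words d" for W
  proof (cases "\<exists>\<alpha> \<beta>. W = [[\<alpha>, \<beta>]]")
    case True
    then obtain \<alpha> \<beta> where W': "W = [[\<alpha>, \<beta>]]" by blast
    then have homs: "\<alpha> \<in> homs d" "\<beta> \<in> homs d"
      using W by (auto simp: words_def packets_def)
    have sets: "{j. j < length W \<and> 2 \<le> length (W ! j)} = {0}"
      by (auto simp: W')
    have mu: "{j. j + 1 < length [\<alpha>, \<beta>]} = {0}"
      by auto
    have "?f (m_map d W) = ksgn (sdeg d \<alpha>) * vf_trace d (wedge \<alpha> \<beta>)"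
      unfolding W' m_map_def mu_def mu
      by (simp add: trace_word_single mu2_in_homs homs)
         (simp add: mu2_def vf_trace_scaleR)
    moreover have "?f (ell_map d W) = 0"
      using W by (simp add: trace_cochain_ell_map words_def)
    ultimately have C: "?C = - (ksgn (sdeg d \<alpha>) * (f1 \<alpha> * vf_trace d \<beta> + vf_trace d \<alpha> * f1 \<beta>))"
      by (simp add: linear_add[OF linear_trace_cochain] vf_trace_wedge homs ksgn_def)
    have "?A = ksgn (sdeg d \<alpha>) * f1 \<alpha> * vf_trace d \<beta>"
      unfolding sets by (simp add: W' trace_word_single homs ksgn_def)
    moreover have "?B = vf_trace d \<alpha> * f1 \<beta>"
      unfolding sets by (simp add: W' trace_word_single homs)
    moreover have "ksgn (sdeg d \<alpha>) * vf_trace d \<alpha> = vf_trace d \<alpha>"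
      using sdeg_vf_trace[OF homs(1)] by (cases "vf_trace d \<alpha> = 0") auto
    ultimately show ?thesis
      unfolding C by (simp add: distrib_left flip: mult.assoc)
  next
    case False
    \<comment> \<open>\<open>X\<close> stands for both \<open>tl (W ! j)\<close> and
      \<open>butlast (W ! j)\<close>: removing an end factor leaves a lone factor only if the word
      was one packet of length 2.\<close>
    have trace0: "trace_word d (W[j := X]) = 0" if "j < length W" "2 \<le> length (W ! j)"
      "length X = length (W ! j) - 1" for j X
    proof (rule trace_word_eq_0, rule notI)
      fix \<alpha> assume W': "W[j := X] = [[\<alpha>]]"
      then have "length W = 1"
        using length_list_update[of W j X] by simp
      then have "W = [W ! 0]" "j = 0"
        using that by (auto simp: length_Suc_conv)
      moreover from this W' have "X = [\<alpha>]"
        by (metis list_update_code(2) list.inject)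
      ultimately have "length (W ! 0) = 2"
        using that by simp
      then show False
        using False \<open>W = [W ! 0]\<close> by (auto simp: length_Suc_conv numeral_2_eq_2)
    qed
    then have "?A = 0" "?B = 0"
      by (auto intro!: sum.neutral)
    moreover have "?C = 0"
      using False W
      by (simp add: linear_add[OF linear_trace_cochain] trace_cochain_m_map trace_cochain_ell_map
          words_def)
    ultimately show ?thesis by simp
  qed
  then have "dCH_hom d (-1) ?f = lin_ext (\<lambda>_. 0)"
    unfolding dCH_hom_def by (intro arg_cong[where f = lin_ext]) (simp add: fun_eq_iff)
  then show ?thesis
    using dCH_homogeneous[OF linear_trace_cochain trace_cochain_homogeneous] by simp
qed

lemma trace_cochain_nonzero:
  assumes "d \<ge> 1"
  shows "trace_cochain d \<noteq> (\<lambda>_. 0)"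
proof -
  \<comment> \<open>\<open>p\<close> is the first coordinate function and \<alpha> the linear vector
    field that it multiplies in the first direction, of trace 1; \<open>d \<ge> 1\<close> makes the
    index 1 available.\<close>
  define p :: mpoly where "p = Poly_Mapping.single (Poly_Mapping.single 1 1) 1"
  define \<alpha> :: polyvec where "\<alpha> = Poly_Mapping.single {1} p"
  have p: "p \<noteq> 0"
    by (metis lookup_single_eq lookup_zero one_neq_zero p_def)
  have "homogeneous_mpoly d 1 p"
    using assms by (simp add: homogeneous_mpoly_def p_def)
  then have "\<alpha> \<in> hom_polyvec d 1"
    using assms by (simp add: hom_polyvec_def \<alpha>_def p)
  then have "\<alpha> \<in> homs d"
    by (auto simp: homs_def)
  have "vf_trace d \<alpha> = (\<Sum>i = 1..d. if i = 1 then 1 else 0)"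
    unfolding vf_trace_def \<alpha>_def p_def
    by (intro sum.cong) (auto simp: lookup_single when_def)
  then have "vf_trace d \<alpha> = 1"
    using assms by simp
  then have "trace_cochain d (gen [[\<alpha>]]) \<noteq> 0"
    using \<open>\<alpha> \<in> homs d\<close> by (simp add: trace_word_single)
  then show ?thesis by metis
qed


section \<open>The resulting class in cohomology\<close>

lemma dCH_zero: "dCH d (\<lambda>_. 0) = (\<lambda>_. 0)"
  by (simp add: dCH_def hom_component_def)

lemma zero_in_cochains: "(\<lambda>_. 0) \<in> cochains d N"
  by (simp add: cochains_def linear_zero)

text \<open>The zero classes fill all weights other than 1 in the nonzero element built
  below.\<close>

lemma zero_class_in_cohomology: "zero_class d N \<in> cohomology d N"
  unfolding zero_class_def cohomology_def
  by (rule quotientI) (simp add: cocycles_def zero_in_cochains dCH_zero)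

theorem mainTheorem1:
  fixes d :: nat
  assumes "d \<ge> 1"
  shows "\<exists>c \<in> CH_cohomology d. c \<noteq> CH_zero d"
proof -
  let ?f = "trace_cochain d"
  define u where "u = cohomologous d 1 `` {?f}"
  \<comment> \<open>The trace class sits in weight 1 and the zero class in every other weight, so
    the support is finite.\<close>
  define c where "c = (CH_zero d)(1 := u)"
  have cocycle: "?f \<in> cocycles d 1"
    by (simp add: cocycles_def trace_cochain_in_cochains dCH_trace_cochain del: One_nat_def)
  \<comment> \<open>For \<open>N = 1\<close> the source \<open>cochains d (N - 1)\<close> is the
    zero space, so a nonzero cocycle cannot be a coboundary.\<close>
  have coboundaries: "coboundaries d 1 = {\<lambda>_. 0}"
    by (simp add: coboundaries_def cochains_0 dCH_zero)
  \<comment> \<open>The two classes are told apart by the element \<open>?f\<close>: it lies in its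
    own class, and lying in the zero class would force it to vanish.\<close>
  have "?f \<in> u"
    using cocycle coboundaries by (simp add: u_def cohomologous_def)
  moreover have "?f \<notin> zero_class d 1"
    using trace_cochain_nonzero[OF assms] coboundaries
    by (auto simp: zero_class_def cohomologous_def fun_eq_iff)
  ultimately have "c 1 \<noteq> CH_zero d 1"
    by (auto simp: c_def CH_zero_def)
  moreover have "c \<in> CH_cohomology d"
  proof -
    have "u \<in> cohomology d 1"
      unfolding u_def cohomology_def using cocycle by (rule quotientI)
    then have "c \<in> (\<Pi>\<^sub>E N \<in> {1..}. cohomology d N)"
      by (auto simp: c_def CH_zero_def PiE_def Pi_def extensional_def zero_class_in_cohomology)
    moreover have "{N \<in> {1..}. c N \<noteq> zero_class d N} \<subseteq> {1}"
      by (auto simp: c_def CH_zero_def)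
    ultimately show ?thesis
      by (auto simp: CH_cohomology_def intro: finite_subset)
  qed
  ultimately show ?thesis by metis
qed

end
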